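(* If $0<\epsilon \leq 1/2$ and $k \geq 2$ is an integer, then $n(k,\epsilon)> \epsilon^{-(k-1)/2}$.
   Context: $\mathcal{F}_k$ denotes the family of $2$-edge-colored complete graphs on $2k$ vertices in which one of the two colors forms either a clique of order $k$ or two disjoint cliques of order $k$ (that is, the edges of that color are exactly the edges of a complete graph on some $k$ of the $2k$ vertices, or exactly the edges of two complete graphs on complementary sets of $k$ vertices each; all other edges have the other color). A $2$-edge-coloring of $K_n$ contains a member of $\mathcal{F}_k$ if there are $2k$ vertices on which the induced $2$-edge-colored complete graph is a member of $\mathcal{F}_k$. $n(k,\epsilon)$ denotes the minimum $n_0$ such that every $2$-edge-coloring of the complete graph $K_n$ with $n \geq n_0$ which has at least $\epsilon\binom{n}{2}$ edges in each color contains a member of $\mathcal{F}_k$. Throughout the paper, floor and ceiling signs are systematically omitted whenever they are not crucial. *)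

theory Defs
  imports Complex_Main "HOL-Library.Ramsey" "HOL-Library.Extended_Real"
begin

text \<open>
  A 2-edge-coloring of the complete graph on a vertex set \<open>V\<close> is a function
  \<open>f :: 'a set \<Rightarrow> bool\<close>, of which only the values on the edges, i.e. on the two-element
  subsets \<open>[V]\<^bsup>2\<^esup>\<close>, matter; the two truth values are the two colors.
\<close>

definition color_class :: "'a set \<Rightarrow> ('a set \<Rightarrow> bool) \<Rightarrow> bool \<Rightarrow> 'a set set" where
  "color_class V f c = {e \<in> [V]\<^bsup>2\<^esup>. f e = c}"

text \<open>
  The complete graph on \<open>W\<close> colored by \<open>f\<close> is a member of the family \<open>\<F>\<^sub>k\<close>. Either color \<open>c\<close>
  may play the role of the color forming the clique(s).
\<close>

definition in_F :: "nat \<Rightarrow> 'a set \<Rightarrow> ('a set \<Rightarrow> bool) \<Rightarrow> bool" where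
  "in_F k W f \<longleftrightarrow> finite W \<and> card W = 2 * k \<and>
     (\<exists>c. \<exists>A\<subseteq>W. card A = k \<and>
        (color_class W f c = [A]\<^bsup>2\<^esup> \<or> color_class W f c = [A]\<^bsup>2\<^esup> \<union> [W - A]\<^bsup>2\<^esup>))"

definition contains_F :: "nat \<Rightarrow> 'a set \<Rightarrow> ('a set \<Rightarrow> bool) \<Rightarrow> bool" where
  "contains_F k V f \<longleftrightarrow> (\<exists>W\<subseteq>V. in_F k W f)"

definition forces_F :: "nat \<Rightarrow> real \<Rightarrow> nat \<Rightarrow> bool" where
  "forces_F k \<epsilon> n\<^sub>0 \<longleftrightarrow>
     (\<forall>n\<ge>n\<^sub>0. \<forall>f. (\<forall>c. real (card (color_class {..<n} f c)) \<ge> \<epsilon> * real (n choose 2))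
        \<longrightarrow> contains_F k {..<n} f)"

text \<open>
  The number \<open>n(k,\<epsilon>)\<close>. It is an extended natural number, so that it is meaningful without
  a proof that a suitable \<open>n\<^sub>0\<close> exists: the infimum is the minimum whenever there is one,
  and \<open>\<infinity>\<close> otherwise.
\<close>

definition n_min :: "nat \<Rightarrow> real \<Rightarrow> enat" where
  "n_min k \<epsilon> = Inf {enat n\<^sub>0 | n\<^sub>0. forces_F k \<epsilon> n\<^sub>0}"

end

theory Submission
  imports Defs
begin

text \<open>
  For \<open>k \<le> 3\<close> color a star in one color: no star contains a member of \<open>\<F>\<^sub>k\<close>, and its density
  \<open>2 / n\<close> is large enough. For \<open>k \<ge> 4\<close> choose \<open>\<lceil>\<epsilon> N\<rceil>\<close> of the \<open>N\<close> edges uniformly at random; a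
  given set of \<open>s\<close> edges is chosen with probability at most \<open>4 \<epsilon>\<^sup>s\<close>, so by the union bound some
  choice contains neither a \<open>K\<^sub>k\<close> nor a \<open>K\<^sub>k\<^sub>,\<^sub>k\<close>, one of which is present in the chosen color in
  every member of \<open>\<F>\<^sub>k\<close>. The number \<open>N\<close> must be even, since for \<open>\<epsilon> = 1/2\<close> both
  colors have to occur equally often; this is achieved by adding at most two vertices.
\<close>

section \<open>Structure common to the members of the family\<close>

definition bipartite_edges :: "'a set \<Rightarrow> 'a set \<Rightarrow> 'a set set" where
  "bipartite_edges A B = (\<lambda>(a, b). {a, b}) ` (A \<times> B)"

lemma bipartite_edges_subset_nsets:
  assumes "A \<subseteq> V" "B \<subseteq> V" "A \<inter> B = {}"
  shows "bipartite_edges A B \<subseteq> [V]\<^bsup>2\<^esup>"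
  using assms by (auto simp: bipartite_edges_def)

lemma card_bipartite_edges:
  assumes "A \<inter> B = {}"
  shows "card (bipartite_edges A B) = card A * card B"
proof -
  have "inj_on (\<lambda>(a, b). {a, b}) (A \<times> B)"
    using assms by (auto simp: inj_on_def doubleton_eq_iff)
  then show ?thesis
    by (simp add: bipartite_edges_def card_image card_cartesian_product)
qed

text \<open>The two shapes in the family differ only in the colors inside \<open>W - A\<close>.
  Forgetting those edges leaves one description that covers both shapes and suffices for the lower
  bound.\<close>

lemma in_F_bicolored:
  assumes "in_F k W f"
  obtains c A B where "A \<subseteq> W" "B \<subseteq> W" "A \<inter> B = {}" "card A = k" "card B = k"
    "\<And>e. e \<in> [A]\<^bsup>2\<^esup> \<Longrightarrow> f e = c" "\<And>e. e \<in> bipartite_edges A B \<Longrightarrow> f e = (\<not> c)"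
proof -
  from assms obtain c A where W: "finite W" "card W = 2 * k" and A: "A \<subseteq> W" "card A = k"
    and col: "color_class W f c = [A]\<^bsup>2\<^esup> \<or> color_class W f c = [A]\<^bsup>2\<^esup> \<union> [W - A]\<^bsup>2\<^esup>"
    unfolding in_F_def by blast
  show thesis
  proof (rule that[of A "W - A" c])
    show "card (W - A) = k"
      using W A by (simp add: card_Diff_subset finite_subset)
    show "f e = c" if "e \<in> [A]\<^bsup>2\<^esup>" for e
      using col that unfolding color_class_def by blast
    show "f e = (\<not> c)" if "e \<in> bipartite_edges A (W - A)" for e
    proof -
      have "e \<in> [W]\<^bsup>2\<^esup>"
        using that bipartite_edges_subset_nsets[of A W "W - A"] A by blast
      moreover have "e \<notin> [A]\<^bsup>2\<^esup>" "e \<notin> [W - A]\<^bsup>2\<^esup>"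
        using that by (auto simp: bipartite_edges_def nsets_def)
      ultimately show ?thesis
        using col unfolding color_class_def by blast
    qed
  qed (use A in auto)
qed

section \<open>Star colorings\<close>

text \<open>Two disjoint edges run between the sides, so these edges cannot all pass through
  \<open>v\<close>. If none does, then all edges inside \<open>A\<close> pass through
  \<open>v\<close>; hence \<open>v\<close> lies in \<open>A\<close>, and so on an edge between the
  sides after all.\<close>

lemma star_not_contains_F:
  assumes "k \<ge> 2"
  shows "\<not> contains_F k V (\<lambda>e. v \<in> e)"
proof
  assume "contains_F k V (\<lambda>e. v \<in> e)"
  then obtain W where "in_F k W (\<lambda>e. v \<in> e)"
    unfolding contains_F_def by blast
  then obtain c A B where AB: "A \<inter> B = {}" "card A = k" "card B = k"
    and inner: "\<And>e. e \<in> [A]\<^bsup>2\<^esup> \<Longrightarrow> (v \<in> e) = c"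
    and cross: "\<And>e. e \<in> bipartite_edges A B \<Longrightarrow> (v \<in> e) = (\<not> c)"
    by (rule in_F_bicolored) blast
  obtain a a' where a: "a \<in> A" "a' \<in> A" "a \<noteq> a'"
    using AB assms card_le_Suc0_iff_eq[of A] by (metis card.infinite not_less_eq_eq
        numeral_2_eq_2 zero_le)
  obtain b b' where b: "b \<in> B" "b' \<in> B" "b \<noteq> b'"
    using AB assms card_le_Suc0_iff_eq[of B] by (metis card.infinite not_less_eq_eq
        numeral_2_eq_2 zero_le)
  have "(v \<in> {a, a'}) = c"
    using a by (intro inner) auto
  moreover have cross': "(v \<in> {x, y}) = (\<not> c)" if "x \<in> A" "y \<in> B" for x y
    using that by (intro cross) (auto simp: bipartite_edges_def)
  moreover have "a \<noteq> b'" "b \<noteq> a'"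
    using a b AB(1) by blast+
  ultimately show False
    using cross'[OF a(1) b(1)] cross'[OF a(2) b(2)] cross'[OF a(2) b(1)] a(3) b(3) by auto
qed

lemma real_choose_two: "real (n choose 2) = real n * (real n - 1) / 2"
  by (induction n) (simp_all add: numeral_2_eq_2 field_simps)

lemma card_color_class_False_True:
  assumes "finite V"
  shows "card (color_class V f False) + card (color_class V f True) = card V choose 2"
proof -
  have "card (color_class V f False \<union> color_class V f True)
      = card (color_class V f False) + card (color_class V f True)"
    using assms by (intro card_Un_disjoint) (auto simp: color_class_def finite_imp_finite_nsets)
  moreover have "color_class V f False \<union> color_class V f True = [V]\<^bsup>2\<^esup>"
    by (auto simp: color_class_def)
  ultimately show ?thesis
    by (simp add: card_nsets)
qed

lemma card_star_color_class:
  assumes "finite V" "v \<in> V"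
  shows "card (color_class V (\<lambda>e. v \<in> e) True) = card V - 1"
proof -
  have "color_class V (\<lambda>e. v \<in> e) True = bipartite_edges {v} (V - {v})"
    using assms by (auto simp: color_class_def bipartite_edges_def nsets_2_eq insert_commute
        doubleton_eq_iff image_iff)
  then show ?thesis
    using assms by (simp add: card_bipartite_edges)
qed

lemma star_not_forces_F:
  fixes \<epsilon> :: real
  assumes "k \<ge> 2" "0 < \<epsilon>" "\<epsilon> \<le> 1/2" "\<epsilon> * real n\<^sub>0 \<le> 2"
  shows "\<not> forces_F k \<epsilon> n\<^sub>0"
proof
  \<comment> \<open>From four vertices on, a star takes at most half of the edges, so the other
    color is dense enough as well. Passing to four vertices preserves
    \<open>\<epsilon> * real n \<le> 2\<close> because \<open>\<epsilon> \<le> 1/2\<close>.\<close>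
  define n where "n = max n\<^sub>0 4"
  define f where "f = (\<lambda>e. (0::nat) \<in> e)"
  have n: "n \<ge> 4" "n \<ge> n\<^sub>0" "\<epsilon> * real n \<le> 2"
    using assms by (auto simp: n_def max_def)
  have T: "real (card (color_class {..<n} f True)) = real n - 1"
    using n unfolding f_def by (subst card_star_color_class) (auto simp: of_nat_diff)
  have C: "real (n choose 2) = real n * (real n - 1) / 2"
    using n(1) by (simp add: real_choose_two)
  have F: "real (card (color_class {..<n} f False)) = real (n choose 2) - (real n - 1)"
    using card_color_class_False_True[of "{..<n}" f] T by (simp flip: of_nat_add)
  have "\<epsilon> * real (n choose 2) \<le> real n - 1"
    using mult_right_mono[OF n(3), of "real n - 1"] n(1) by (simp add: C)
  moreover have "\<epsilon> * real (n choose 2) \<le> real (n choose 2) - (real n - 1)"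
  proof -
    have "\<epsilon> * real (n choose 2) \<le> 1/2 * real (n choose 2)"
      using assms by (intro mult_right_mono) auto
    moreover have "4 * (real n - 1) \<le> real n * (real n - 1)"
      using n(1) by (intro mult_right_mono) auto
    ultimately show ?thesis
      by (simp add: C)
  qed
  ultimately have "real (card (color_class {..<n} f c)) \<ge> \<epsilon> * real (n choose 2)" for c
    using T F by (cases c) auto
  moreover assume "forces_F k \<epsilon> n\<^sub>0"
  ultimately have "contains_F k {..<n} f"
    using n(2) unfolding forces_F_def by simp
  then show False
    using star_not_contains_F[OF assms(1), of "{..<n}" 0] unfolding f_def by contradiction
qed

section \<open>Probability that a random edge set contains given edges\<close>

text \<open>Removing \<open>S\<close> is a bijection onto the subsets of \<open>E - S\<close> of
  size \<open>m - card S\<close>. The zero case is split off, since truncated subtraction would make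
  the binomial coefficient 1 there.\<close>

lemma card_nsets_superset:
  assumes "finite E" "S \<subseteq> E"
  shows "card {M \<in> [E]\<^bsup>m\<^esup>. S \<subseteq> M}
    = (if card S \<le> m then (card E - card S) choose (m - card S) else 0)"
proof (cases "card S \<le> m")
  case True
  have finS: "finite S"
    using assms finite_subset by blast
  have "{M \<in> [E]\<^bsup>m\<^esup>. S \<subseteq> M} = (\<lambda>M. S \<union> M) ` nsets (E - S) (m - card S)"
  proof (intro equalityI subsetI)
    fix M assume "M \<in> {M \<in> [E]\<^bsup>m\<^esup>. S \<subseteq> M}"
    then have "M - S \<in> nsets (E - S) (m - card S)" "M = S \<union> (M - S)"
      using finS by (auto simp: nsets_def card_Diff_subset)
    then show "M \<in> (\<lambda>M. S \<union> M) ` nsets (E - S) (m - card S)"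
      by blast
  next
    fix M assume "M \<in> (\<lambda>M. S \<union> M) ` nsets (E - S) (m - card S)"
    then obtain M' where M': "M = S \<union> M'" "M' \<subseteq> E - S" "finite M'" "card M' = m - card S"
      by (auto simp: nsets_def)
    then have "card M = card S + card M'"
      using finS card_Un_disjoint[of S M'] by blast
    then show "M \<in> {M \<in> [E]\<^bsup>m\<^esup>. S \<subseteq> M}"
      using M' True assms finS by (auto simp: nsets_def)
  qed
  moreover have "inj_on (\<lambda>M. S \<union> M) (nsets (E - S) (m - card S))"
    by (auto simp: inj_on_def nsets_def)
  ultimately show ?thesis
    using True assms finS by (simp add: card_image card_nsets card_Diff_subset)
next
  case False
  have "{M \<in> [E]\<^bsup>m\<^esup>. S \<subseteq> M} = {}"
    using False card_mono by (auto simp: nsets_def)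
  then show ?thesis
    using False by (simp only: card.empty if_False)
qed

text \<open>Supplies the ratio \<open>(m - s) / (N - s)\<close> of consecutive terms for an
  induction on \<open>s\<close>.\<close>

lemma binomial_diff_absorption:
  assumes "s < m" "m \<le> N"
  shows "real (N - s) * real ((N - Suc s) choose (m - Suc s))
    = real (m - s) * real ((N - s) choose (m - s))"
  using times_binomial_minus1_eq[of "m - s" "N - s"] assms
  unfolding of_nat_mult[symmetric] of_nat_eq_iff by simp

text \<open>
  The factors \<open>(m - i) / (N - i)\<close> of the quotient of the two binomials are at most \<open>\<epsilon>\<close> only from
  \<open>i = 2\<close> on; the factor 4 pays for the first two.
\<close>

lemma binomial_diff_le:
  fixes \<epsilon> :: real
  assumes "0 < \<epsilon>" "\<epsilon> \<le> 1/2" "real m < \<epsilon> * real N + 1" "2 \<le> s" "s \<le> m" "m \<le> N"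
  shows "real ((N - s) choose (m - s)) \<le> 4 * \<epsilon> ^ s * real (N choose m)"
  using assms(4,5)
proof (induction s rule: nat_induct_at_least)
  case base
  have m: "2 \<le> m" "m \<le> N"
    using base assms by auto
  have "real N * real (N - 1) * real ((N - 2) choose (m - 2))
      = real m * real (m - 1) * real (N choose m)"
    using binomial_diff_absorption[of 0 m N] binomial_diff_absorption[of 1 m N] m
    by (simp add: numeral_2_eq_2 mult.assoc mult.left_commute del: of_nat_diff)
  \<comment> \<open>\<open>m \<ge> 2\<close> gives \<open>m \<le> 2 * (m - 1)\<close>, and
    \<open>m - 1 < \<epsilon> * N\<close>; this costs one factor 2. The other comes from
    \<open>N \<le> 2 * (N - 1)\<close> in the next estimate.\<close>
  also have "\<dots> \<le> (2 * \<epsilon> * real N) * (\<epsilon> * real N) * real (N choose m)"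
    using assms(3) m by (intro mult_right_mono mult_mono) (auto simp: of_nat_diff)
  also have "\<dots> \<le> (2 * \<epsilon> * real N) * (\<epsilon> * (2 * real (N - 1))) * real (N choose m)"
    using assms(1) m by (intro mult_right_mono mult_left_mono) (auto simp: of_nat_diff)
  also have "\<dots> = real N * real (N - 1) * (4 * \<epsilon> ^ 2 * real (N choose m))"
    by (simp add: power2_eq_square)
  finally show ?case
    using m by (subst (asm) mult_le_cancel_left_pos) auto
next
  case (Suc s)
  have s: "s < m" "s < N" "2 \<le> s"
    using Suc assms by auto
  \<comment> \<open>Since \<open>m - \<epsilon> * N < 1\<close>, the new factor is at most
    \<open>\<epsilon>\<close> as soon as \<open>s * (1 - \<epsilon>) \<ge> 1\<close>.\<close>
  have "real s * (1 - \<epsilon>) \<ge> 2 * (1/2)"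
    using s assms by (intro mult_mono) auto
  then have "real (m - s) \<le> \<epsilon> * real (N - s)"
    using s assms(3) by (simp add: of_nat_diff algebra_simps)
  then have "real (N - s) * real ((N - Suc s) choose (m - Suc s))
      \<le> (\<epsilon> * real (N - s)) * real ((N - s) choose (m - s))"
    using binomial_diff_absorption[OF s(1) assms(6)] by (simp add: mult_right_mono)
  also have "\<dots> \<le> (\<epsilon> * real (N - s)) * (4 * \<epsilon> ^ s * real (N choose m))"
    using Suc s assms by (intro mult_left_mono) auto
  also have "\<dots> = real (N - s) * (4 * \<epsilon> ^ Suc s * real (N choose m))"
    by simp
  finally show ?case
    using s by (subst (asm) mult_le_cancel_left_pos) auto
qed

text \<open>Divided by \<open>card E choose m\<close>, this bounds the probability that a uniformly
  random \<open>m\<close>-subset of \<open>E\<close> contains \<open>S\<close>. The summand 1 in the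
  bound on \<open>m\<close> leaves room for rounding up.\<close>

lemma card_nsets_superset_le:
  fixes \<epsilon> :: real
  assumes "finite E" "S \<subseteq> E" "card S = s" "2 \<le> s" "m \<le> card E"
    and "0 < \<epsilon>" "\<epsilon> \<le> 1/2" "real m < \<epsilon> * real (card E) + 1"
  shows "real (card {M \<in> [E]\<^bsup>m\<^esup>. S \<subseteq> M}) \<le> 4 * \<epsilon> ^ s * real (card E choose m)"
proof (cases "s \<le> m")
  case True
  then show ?thesis
    using assms binomial_diff_le[of \<epsilon> m "card E" s] by (simp add: card_nsets_superset)
next
  case False
  then show ?thesis
    using assms by (simp add: card_nsets_superset)
qed

section \<open>Arithmetic of the number of vertices\<close>

text \<open>In the falling factorial the factors from \<open>n - 2\<close> on are at most
  \<open>n - 2\<close>, and \<open>n * (n - 1) \<le> 2 * (n - 2)^2\<close> once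
  \<open>n \<ge> 6\<close>. The base \<open>n - 2\<close> compensates for the up to two vertices
  added for parity.\<close>

lemma fact_times_binomial_le:
  assumes "k \<ge> 2" "n \<ge> 6"
  shows "fact k * (n choose k) \<le> 2 * (n - 2) ^ k"
proof -
  define j p where "j = k - 2" and "p = n - 2"
  then have j: "k = Suc (Suc j)" and p: "n = Suc (Suc p)" "p \<ge> 4"
    using assms by auto
  have "fact k * (n choose k) = n * (Suc p * (fact j * (p choose j)))"
    using Suc_times_binomial_eq[of p j] Suc_times_binomial_eq[of "Suc p" "Suc j"]
    by (simp add: j p algebra_simps)
  also have "\<dots> \<le> n * (Suc p * p ^ j)"
    using binomial_fact_pow[of p j] by (intro mult_left_mono) (auto simp: mult.commute)
  also have "\<dots> = (Suc (Suc p) * Suc p) * p ^ j"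
    by (simp only: p mult.assoc)
  also have "\<dots> \<le> (2 * p * p) * p ^ j"
  proof (intro mult_right_mono)
    have "4 * p \<le> p * p"
      using p(2) by (rule mult_right_mono) simp
    moreover have "Suc (Suc p) * Suc p = p * p + 3 * p + 2"
      by simp
    ultimately show "Suc (Suc p) * Suc p \<le> 2 * p * p"
      using p(2) by linarith
  qed simp
  also have "\<dots> = 2 * (n - 2) ^ k"
    by (simp add: j p)
  finally show ?thesis .
qed

text \<open>Residues 0 and 1 modulo 4 make the number of edges even, and adding 2 moves the residues
  2 and 3 there.\<close>

lemma exists_large_even_choose_two:
  fixes n\<^sub>0 :: nat
  obtains n where "n\<^sub>0 \<le> n" "n \<le> n\<^sub>0 + 2" "even (n choose 2)"
proof -
  have even: "even (n choose 2)" if "n mod 4 = 0 \<or> n mod 4 = 1" for n :: nat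
  proof -
    have "4 dvd n \<or> 4 dvd n - 1"
      using that by presburger
    then have "2 * 2 dvd n * (n - 1)"
      by auto
    then show ?thesis
      unfolding choose_two by (elim dvdE) simp
  qed
  have "(n\<^sub>0 mod 4 = 0 \<or> n\<^sub>0 mod 4 = 1) \<or> ((n\<^sub>0 + 2) mod 4 = 0 \<or> (n\<^sub>0 + 2) mod 4 = 1)"
    by presburger
  then show thesis
    using that[of "n\<^sub>0"] that[of "n\<^sub>0 + 2"] even by auto
qed

section \<open>The union bound over cliques and complete bipartite graphs\<close>

text \<open>If the chosen color forms the cliques, it contains all edges inside one side; otherwise
  it contains all edges between the sides.\<close>

lemma contains_F_edge_set_cases:
  assumes "contains_F k V (\<lambda>e. e \<in> M)"
  obtains A where "A \<in> [V]\<^bsup>k\<^esup>" "[A]\<^bsup>2\<^esup> \<subseteq> M"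
    | A B where "A \<in> [V]\<^bsup>k\<^esup>" "B \<in> [V]\<^bsup>k\<^esup>" "A \<inter> B = {}" "bipartite_edges A B \<subseteq> M"
proof -
  obtain W where W: "W \<subseteq> V" "in_F k W (\<lambda>e. e \<in> M)"
    using assms unfolding contains_F_def by blast
  from W(2) obtain c A B where AB: "A \<subseteq> W" "B \<subseteq> W" "A \<inter> B = {}" "card A = k" "card B = k"
    and "\<And>e. e \<in> [A]\<^bsup>2\<^esup> \<Longrightarrow> (e \<in> M) = c" "\<And>e. e \<in> bipartite_edges A B \<Longrightarrow> (e \<in> M) = (\<not> c)"
    by (rule in_F_bicolored) blast
  moreover have "finite W"
    using W(2) unfolding in_F_def by blast
  then have "A \<in> [V]\<^bsup>k\<^esup>" "B \<in> [V]\<^bsup>k\<^esup>"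
    using AB W(1) by (auto simp: nsets_def intro: finite_subset)
  ultimately show thesis
    using that by (cases c) blast+
qed

lemma exists_edge_set_not_contains_F:
  fixes \<epsilon> :: real
  assumes "k \<ge> 4" "0 < \<epsilon>" "\<epsilon> \<le> 1/2" "finite V" "card V \<ge> 6"
    and m: "m \<le> card V choose 2" "real m < \<epsilon> * real (card V choose 2) + 1"
    and small: "real (card V - 2) ^ k * \<epsilon> ^ (k choose 2) \<le> 1"
  obtains M where "M \<subseteq> [V]\<^bsup>2\<^esup>" "card M = m" "\<not> contains_F k V (\<lambda>e. e \<in> M)"
proof -
  define E where "E = [V]\<^bsup>2\<^esup>"
  \<comment> \<open>The random choice is phrased as counting: \<open>T\<close> is the number of all
    choices, \<open>y\<close> the number of candidate vertex sets, and \<open>4 * z\<close> will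
    bound the probability of a fixed clique.\<close>
  define T where "T = real (card E choose m)"
  define y where "y = real (card V choose k)"
  define z where "z = \<epsilon> ^ (k choose 2)"
  define clq where "clq = (\<Union>A\<in>[V]\<^bsup>k\<^esup>. {M \<in> [E]\<^bsup>m\<^esup>. [A]\<^bsup>2\<^esup> \<subseteq> M})"
  define I where "I = {(A, B) \<in> [V]\<^bsup>k\<^esup> \<times> [V]\<^bsup>k\<^esup>. A \<inter> B = {}}"
  define bip where "bip = (\<Union>(A, B)\<in>I. {M \<in> [E]\<^bsup>m\<^esup>. bipartite_edges A B \<subseteq> M})"
  have finE: "finite E" and cardE: "card E = card V choose 2"
    using assms by (auto simp: E_def finite_imp_finite_nsets card_nsets)
  have finV: "finite ([V]\<^bsup>k\<^esup>)" and cardV: "real (card ([V]\<^bsup>k\<^esup>)) = y"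
    using assms by (auto simp: finite_imp_finite_nsets card_nsets y_def)
  have I: "I \<subseteq> [V]\<^bsup>k\<^esup> \<times> [V]\<^bsup>k\<^esup>"
    by (auto simp: I_def)
  have finI: "finite I"
    using I finV finite_subset by blast
  have cardI: "real (card I) \<le> y * y"
    using card_mono[OF _ I] finV by (simp add: card_cartesian_product flip: cardV of_nat_mult)
  have T: "T > 0"
    using m cardE by (simp add: T_def)
  have z: "0 < z" and y: "0 \<le> y"
    using assms by (auto simp: z_def y_def)
  have k2: "2 \<le> k choose 2"
  proof -
    have "4 * 3 \<le> k * (k - 1)"
      using assms(1) by (intro mult_le_mono) auto
    then show ?thesis
      unfolding choose_two by linarith
  qed
  \<comment> \<open>The bipartite graph has at least twice as many edges as the clique, so its
    probability is at most \<open>4 * z\<^sup>2\<close>. This offsets the up to \<open>y * y\<close>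
    pairs, and both bounds depend on \<open>y * z\<close> only.\<close>
  have kk: "2 * (k choose 2) \<le> k * k"
    using mult_le_mono2[of "k - 1" k k] unfolding choose_two by linarith

  have "real (card {M \<in> [E]\<^bsup>m\<^esup>. [A]\<^bsup>2\<^esup> \<subseteq> M}) \<le> 4 * z * T" if "A \<in> [V]\<^bsup>k\<^esup>" for A
    unfolding z_def T_def
  proof (rule card_nsets_superset_le)
    show "[A]\<^bsup>2\<^esup> \<subseteq> E"
      using that unfolding E_def by (intro nsets_mono) (auto simp: nsets_def)
    show "card ([A]\<^bsup>2\<^esup>) = k choose 2"
      using that by (auto simp: nsets_def[of V])
  qed (use assms finE cardE k2 in auto)
  then have "(\<Sum>A\<in>[V]\<^bsup>k\<^esup>. real (card {M \<in> [E]\<^bsup>m\<^esup>. [A]\<^bsup>2\<^esup> \<subseteq> M})) \<le> y * (4 * z * T)"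
    unfolding cardV[symmetric] by (rule sum_bounded_above)
  moreover have "real (card clq) \<le> (\<Sum>A\<in>[V]\<^bsup>k\<^esup>. real (card {M \<in> [E]\<^bsup>m\<^esup>. [A]\<^bsup>2\<^esup> \<subseteq> M}))"
    unfolding clq_def of_nat_sum[symmetric] of_nat_le_iff by (rule card_UN_le[OF finV])
  ultimately have clq: "real (card clq) \<le> 4 * (y * z) * T"
    by (simp add: algebra_simps)

  have "real (card {M \<in> [E]\<^bsup>m\<^esup>. bipartite_edges A B \<subseteq> M}) \<le> 4 * z\<^sup>2 * T"
    if "(A, B) \<in> I" for A B
  proof -
    have "real (card {M \<in> [E]\<^bsup>m\<^esup>. bipartite_edges A B \<subseteq> M}) \<le> 4 * \<epsilon> ^ (k * k) * T"
      unfolding T_def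
    proof (rule card_nsets_superset_le)
      show "bipartite_edges A B \<subseteq> E"
        using that unfolding E_def by (intro bipartite_edges_subset_nsets) (auto simp: I_def nsets_def)
      show "card (bipartite_edges A B) = k * k"
        using that by (subst card_bipartite_edges) (auto simp: I_def nsets_def)
    qed (use assms finE cardE k2 kk in auto)
    also have "\<dots> \<le> 4 * z\<^sup>2 * T"
      using kk assms T unfolding z_def power_mult[symmetric]
      by (intro mult_right_mono mult_left_mono power_decreasing) auto
    finally show ?thesis .
  qed
  then have "(\<Sum>(A, B)\<in>I. real (card {M \<in> [E]\<^bsup>m\<^esup>. bipartite_edges A B \<subseteq> M}))
      \<le> real (card I) * (4 * z\<^sup>2 * T)"
    by (intro sum_bounded_above) auto
  also have "\<dots> \<le> (y * y) * (4 * z\<^sup>2 * T)"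
    using cardI T by (intro mult_right_mono) auto
  also have "\<dots> = 4 * (y * z)\<^sup>2 * T"
    by (simp add: power2_eq_square)
  finally have "(\<Sum>(A, B)\<in>I. real (card {M \<in> [E]\<^bsup>m\<^esup>. bipartite_edges A B \<subseteq> M}))
      \<le> 4 * (y * z)\<^sup>2 * T" .
  moreover have "real (card bip)
      \<le> (\<Sum>(A, B)\<in>I. real (card {M \<in> [E]\<^bsup>m\<^esup>. bipartite_edges A B \<subseteq> M}))"
  proof -
    have "card bip \<le> (\<Sum>p\<in>I. card (case p of (A, B) \<Rightarrow> {M \<in> [E]\<^bsup>m\<^esup>. bipartite_edges A B \<subseteq> M}))"
      unfolding bip_def by (rule card_UN_le[OF finI])
    then show ?thesis
      by (simp add: case_prod_unfold flip: of_nat_sum)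
  qed
  ultimately have bip: "real (card bip) \<le> 4 * (y * z)\<^sup>2 * T"
    by linarith

  \<comment> \<open>The constant is the factor 2 of \<open>fact_times_binomial_le\<close> over
    \<open>4! = 24\<close>. Here \<open>k \<ge> 4\<close> matters: \<open>3! = 6\<close> would give
    only 1/3, too large for the final sum.\<close>
  have yz: "y * z \<le> 1/12"
  proof -
    have "fact 4 \<le> (fact k :: nat)"
      using assms(1) by (rule fact_mono)
    then have "24 * (card V choose k) \<le> fact k * (card V choose k)"
      by (intro mult_right_mono) (simp_all add: fact_numeral)
    also have "\<dots> \<le> 2 * (card V - 2) ^ k"
      using assms by (intro fact_times_binomial_le) auto
    finally have "12 * y \<le> real (card V - 2) ^ k"
      unfolding y_def by (simp flip: of_nat_power)
    then have "12 * y * z \<le> real (card V - 2) ^ k * z"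
      using z by (intro mult_right_mono) auto
    then show ?thesis
      using small by (simp add: z_def)
  qed
  have "real (card (clq \<union> bip)) \<le> real (card clq) + real (card bip)"
    using card_Un_le[of clq bip] by linarith
  also have "\<dots> \<le> (4 * (y * z) + 4 * (y * z)\<^sup>2) * T"
    using clq bip by (simp add: algebra_simps)
  also have "\<dots> \<le> (4 * (1/12) + 4 * (1/12)\<^sup>2) * T"
    using yz T y z by (intro mult_right_mono add_mono mult_left_mono power_mono) auto
  \<comment> \<open>The coefficient is 1/3 + 1/36 = 13/36.\<close>
  also have "\<dots> < T"
    using T by (simp add: power2_eq_square)
  also have "T = real (card ([E]\<^bsup>m\<^esup>))"
    by (simp add: T_def card_nsets)
  finally have "card (clq \<union> bip) < card ([E]\<^bsup>m\<^esup>)"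
    by (simp only: of_nat_less_iff)
  then have "clq \<union> bip \<noteq> [E]\<^bsup>m\<^esup>"
    by auto
  moreover have "clq \<union> bip \<subseteq> [E]\<^bsup>m\<^esup>"
    by (auto simp: clq_def bip_def)
  ultimately obtain M where M: "M \<in> [E]\<^bsup>m\<^esup>" "M \<notin> clq" "M \<notin> bip"
    by blast
  show thesis
  proof (rule that)
    show "M \<subseteq> [V]\<^bsup>2\<^esup>" "card M = m"
      using M(1) by (auto simp: E_def nsets_def)
    show "\<not> contains_F k V (\<lambda>e. e \<in> M)"
    proof
      assume "contains_F k V (\<lambda>e. e \<in> M)"
      then show False
      proof (cases rule: contains_F_edge_set_cases)
        case (1 A)
        then show False
          using M(1,2) unfolding clq_def by blast
      next
        case (2 A B)
        then have "(A, B) \<in> I"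
          unfolding I_def by blast
        then show False
          using 2(4) M(1,3) unfolding bip_def by blast
      qed
    qed
  qed
qed

lemma random_not_forces_F:
  fixes \<epsilon> :: real
  assumes "k \<ge> 4" "0 < \<epsilon>" "\<epsilon> \<le> 1/2" "real n\<^sub>0 ^ k * \<epsilon> ^ (k choose 2) \<le> 1"
  shows "\<not> forces_F k \<epsilon> n\<^sub>0"
proof
  obtain n where n: "n\<^sub>0 \<le> n" "n \<le> n\<^sub>0 + 2" "even (n choose 2)"
    by (rule exists_large_even_choose_two)
  define N where "N = n choose 2"
  define m where "m = nat \<lceil>\<epsilon> * real N\<rceil>"
  \<comment> \<open>Because \<open>h\<close> is an integer and at least
    \<open>\<epsilon> * real N\<close>, rounding up still gives \<open>m \<le> h\<close>, so the
    other color retains at least \<open>h\<close> edges. For odd \<open>N\<close> this would fail at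
    \<open>\<epsilon> = 1/2\<close>.\<close>
  obtain h where h: "N = 2 * h"
    using n(3) unfolding N_def by blast
  have "\<epsilon> * real N \<le> 1/2 * real N"
    using assms by (intro mult_right_mono) auto
  then have Nh: "\<epsilon> * real N \<le> real h"
    by (simp only: h)
  then have "\<lceil>\<epsilon> * real N\<rceil> \<le> int h"
    by (simp only: ceiling_le_iff of_int_of_nat_eq)
  then have mh: "m \<le> h"
    unfolding m_def by linarith
  have "0 \<le> \<epsilon> * real N"
    using assms by simp
  then have m: "\<epsilon> * real N \<le> real m" "real m < \<epsilon> * real N + 1"
    unfolding m_def by linarith+
  obtain M where M: "M \<subseteq> [{..<n}]\<^bsup>2\<^esup>" "card M = m" "\<not> contains_F k {..<n} (\<lambda>e. e \<in> M)"
  proof (cases "n < 2 * k")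
    case True
    \<comment> \<open>With fewer than \<open>2 * k\<close> vertices any edge set of size
      \<open>m\<close> will do. Otherwise \<open>n \<ge> 8\<close>, as large as the counting
      argument requires.\<close>
    have "\<not> contains_F k {..<n} f" for f :: "nat set \<Rightarrow> bool"
    proof
      assume "contains_F k {..<n} f"
      then obtain W where "W \<subseteq> {..<n}" "card W = 2 * k"
        unfolding contains_F_def in_F_def by blast
      then show False
        using True card_mono[of "{..<n}" W] by simp
    qed
    moreover have "m \<le> card ([{..<n}]\<^bsup>2\<^esup>)"
      using mh h by (simp add: card_nsets N_def)
    then obtain M where "M \<subseteq> [{..<n}]\<^bsup>2\<^esup>" "card M = m"
      by (meson obtain_subset_with_card_n)
    ultimately show thesis
      using that by blast
  next
    case False
    \<comment> \<open>\<open>n - 2 \<le> n\<^sub>0\<close>, so the added vertices do not weaken the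
      hypothesis.\<close>
    have "real (n - 2) ^ k * \<epsilon> ^ (k choose 2) \<le> real n\<^sub>0 ^ k * \<epsilon> ^ (k choose 2)"
      using n assms by (intro mult_right_mono power_mono) auto
    also have "\<dots> \<le> 1"
      by (rule assms(4))
    finally have small: "real (n - 2) ^ k * \<epsilon> ^ (k choose 2) \<le> 1" .
    show thesis
    proof (rule exists_edge_set_not_contains_F)
      show "6 \<le> card {..<n}" "real (card {..<n} - 2) ^ k * \<epsilon> ^ (k choose 2) \<le> 1"
        using False assms(1) small unfolding card_lessThan by linarith+
      show "m \<le> card {..<n} choose 2" "real m < \<epsilon> * real (card {..<n} choose 2) + 1"
        using m(2) mh h unfolding card_lessThan N_def[symmetric] by linarith+
    next
      fix M assume "M \<subseteq> [{..<n}]\<^bsup>2\<^esup>" "card M = m" "\<not> contains_F k {..<n} (\<lambda>e. e \<in> M)"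
      then show thesis
        by (rule that)
    qed (use assms in simp_all)
  qed
  define f where "f = (\<lambda>e. e \<in> M)"
  have "color_class {..<n} f True = M"
    using M(1) by (auto simp: color_class_def f_def)
  then have T: "card (color_class {..<n} f True) = m"
    using M(2) by simp
  then have F: "card (color_class {..<n} f False) + m = N"
    using card_color_class_False_True[of "{..<n}" f] by (simp add: N_def)
  have "real (card (color_class {..<n} f c)) \<ge> \<epsilon> * real (n choose 2)" for c
  proof (cases c)
    case True
    then show ?thesis
      using T m(1) by (simp add: N_def)
  next
    case False
    then have "c = False"
      by simp
    moreover have "h \<le> card (color_class {..<n} f False)"
      using F mh h by linarith
    ultimately show ?thesis
      using Nh unfolding N_def[symmetric] by (simp only:)
  qed
  moreover assume "forces_F k \<epsilon> n\<^sub>0"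
  ultimately have "contains_F k {..<n} f"
    using n(1) unfolding forces_F_def by simp
  then show False
    using M(3) unfolding f_def by simp
qed

section \<open>Combining both constructions\<close>

lemma not_forces_F:
  fixes \<epsilon> :: real
  assumes "0 < \<epsilon>" "\<epsilon> \<le> 1/2" "k \<ge> 2" "real n\<^sub>0 \<le> \<epsilon> powr (- (real k - 1) / 2)"
  shows "\<not> forces_F k \<epsilon> n\<^sub>0"
proof (cases "k \<ge> 4")
  case True
  \<comment> \<open>The \<open>k\<close>-th power turns the exponent into minus the number of edges
    of a clique on \<open>k\<close> vertices.\<close>
  have "real n\<^sub>0 ^ k \<le> (\<epsilon> powr (- (real k - 1) / 2)) ^ k"
    using assms(4) by (intro power_mono) auto
  also have "\<dots> = \<epsilon> powr (real k * (- (real k - 1) / 2))"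
    using assms by (intro powr_power) auto
  also have "real k * (- (real k - 1) / 2) = - real (k choose 2)"
    by (simp add: real_choose_two field_simps)
  finally have "real n\<^sub>0 ^ k * \<epsilon> ^ (k choose 2) \<le> 1"
    using assms(1) by (simp add: powr_minus powr_realpow field_simps)
  then show ?thesis
    using True assms by (intro random_not_forces_F)
next
  case False
  \<comment> \<open>For \<open>k \<le> 3\<close> the exponent is at least -1, and
    \<open>\<epsilon> \<le> 1\<close>.\<close>
  have "real n\<^sub>0 \<le> \<epsilon> powr (- 1)"
    using assms(4) False assms by (elim order_trans) (intro powr_mono', auto)
  then have "\<epsilon> * real n\<^sub>0 \<le> 2"
    using assms(1) by (simp add: powr_minus field_simps)
  then show ?thesis
    using assms by (intro star_not_forces_F)
qed

theorem proposition2p3: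
  fixes \<epsilon> :: real and k :: nat
  assumes "0 < \<epsilon>" and "\<epsilon> \<le> 1/2" and "k \<ge> 2"
  shows "ereal_of_enat (n_min k \<epsilon>) > ereal (\<epsilon> powr (- (real k - 1) / 2))"
proof (cases "\<exists>n\<^sub>0. forces_F k \<epsilon> n\<^sub>0")
  case True
  \<comment> \<open>A nonempty set of extended naturals attains its infimum, so \<open>n_min\<close>
    is itself a forcing number.\<close>
  then have "n_min k \<epsilon> \<in> {enat n\<^sub>0 | n\<^sub>0. forces_F k \<epsilon> n\<^sub>0}"
    unfolding n_min_def by (elim exE) (rule wellorder_InfI, blast)
  then obtain n\<^sub>0 where "n_min k \<epsilon> = enat n\<^sub>0" "forces_F k \<epsilon> n\<^sub>0"
    by blast
  moreover from this(2) have "\<not> real n\<^sub>0 \<le> \<epsilon> powr (- (real k - 1) / 2)"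
    using not_forces_F[OF assms] by blast
  ultimately show ?thesis
    by simp
next
  case False
  \<comment> \<open>The infimum of the empty set is infinity, which exceeds every real.\<close>
  then show ?thesis
    by (simp add: n_min_def top_enat_def)
qed

end
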